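(* Let $\Phi(z)=\sum_{j\ge0}c_jz^j/j!$ be a real entire function of genus $1^*$ and let $\Omega(z)$ be in the Laguerre–Pólya class. Then $\Phi(z)$ has only real zeros if and only if the polynomials $$\sum_{j=0}^d\binom dj c_j\,g^*_{d-j}(\Omega;x)$$ have only real zeros for all $d\ge1$.
   Context: An entire function is real if it maps $\mathbb R$ into $\mathbb R$. It is of genus $1^*$ if it has the form $e^{-\alpha z^2}f(z)$ with $\alpha\ge0$ and $f$ entire of genus at most $1$. The Laguerre–Pólya class consists of real entire functions of genus $1^*$ having only real zeros. For $\Psi(z)=\sum_{j\ge 0}e_jz^j/j!$, $g^*_d(\Psi;x):=\sum_{j=0}^d\binom dj e_jx^{d-j}$. *)

theory Defs
  imports "HOL-Complex_Analysis.Complex_Analysis" "HOL-Computational_Algebra.Polynomial"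
begin

definition real_entire :: "(complex \<Rightarrow> complex) \<Rightarrow> bool" where
  "real_entire f \<longleftrightarrow> f holomorphic_on UNIV \<and> (\<forall>x::real. f (of_real x) \<in> \<real>)"

text \<open>
  Genus in the sense of the Hadamard factorization
  \<open>f z = z ^ m * exp (Q z) * (\<Prod>n. E\<^sub>p (z / a n))\<close>, where \<open>a\<close> lists the nonzero zeros of \<open>f\<close> with
  multiplicity, \<open>p\<close> is the least natural number for which \<open>\<Sum>n. 1 / \<bar>a n\<bar> ^ (p + 1)\<close> converges,
  and the genus is the maximum of \<open>p\<close> and \<open>degree Q\<close>.  If \<open>f\<close> has only finitely many zeros, the
  sequence \<open>a\<close> is padded with the value \<open>0\<close>: as division by \<open>0\<close> yields \<open>0\<close> and
  \<open>E\<^sub>p 0 = 1\<close>, these entries contribute neither to the sum nor to the product.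
  The zero function has no such factorization and hence no genus.
\<close>
definition has_genus :: "(complex \<Rightarrow> complex) \<Rightarrow> nat \<Rightarrow> bool" where
  "has_genus f h \<longleftrightarrow>
     (\<exists>(m::nat) (Q :: complex poly) (a :: nat \<Rightarrow> complex) (p::nat).
        summable (\<lambda>n. 1 / norm (a n) ^ (p + 1)) \<and>
        (\<forall>q<p. \<not> summable (\<lambda>n. 1 / norm (a n) ^ (q + 1))) \<and>
        (\<forall>z. f z = z ^ m * exp (poly Q z) * (\<Prod>n. weierstrass_factor p (z / a n))) \<and>
        h = max p (degree Q))"

definition genus_one_star :: "(complex \<Rightarrow> complex) \<Rightarrow> bool" where
  "genus_one_star F \<longleftrightarrow>
     (\<exists>(\<alpha>::real) f. \<alpha> \<ge> 0 \<and> f holomorphic_on UNIV \<and> (\<exists>h\<le>1. has_genus f h) \<and>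
        (\<forall>z. F z = exp (- of_real \<alpha> * z ^ 2) * f z))"

definition only_real_zeros :: "(complex \<Rightarrow> complex) \<Rightarrow> bool" where
  "only_real_zeros f \<longleftrightarrow> (\<forall>z. f z = 0 \<longrightarrow> z \<in> \<real>)"

definition laguerre_polya :: "(complex \<Rightarrow> complex) \<Rightarrow> bool" where
  "laguerre_polya f \<longleftrightarrow> real_entire f \<and> genus_one_star f \<and> only_real_zeros f"

text \<open>
  The zero polynomial counts as having only real zeros.  It does occur: if \<open>\<Phi> z = z ^ 2\<close>
  and \<open>\<Omega> = 1\<close>, the polynomial for \<open>d = 1\<close> vanishes identically.
\<close>
definition poly_only_real_zeros :: "complex poly \<Rightarrow> bool" where
  "poly_only_real_zeros p \<longleftrightarrow> p = 0 \<or> only_real_zeros (poly p)"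

definition exp_coeff :: "(complex \<Rightarrow> complex) \<Rightarrow> nat \<Rightarrow> complex" where
  "exp_coeff f j = (deriv ^^ j) f 0"

lemma exp_coeff_sums:
  assumes "f holomorphic_on UNIV"
  shows "(\<lambda>j. exp_coeff f j * z ^ j / fact j) sums f z"
proof -
  have "(\<lambda>j. (deriv ^^ j) f 0 / fact j * (z - 0) ^ j) sums f z"
    by (rule holomorphic_power_series[where r = "norm z + 1"])
       (use assms holomorphic_on_subset in auto)
  then show ?thesis
    by (simp add: exp_coeff_def)
qed

definition g_star :: "nat \<Rightarrow> (complex \<Rightarrow> complex) \<Rightarrow> complex poly" where
  "g_star d \<Psi> = (\<Sum>j=0..d. monom (of_nat (d choose j) * exp_coeff \<Psi> j) (d - j))"

end

theory Submission
  imports Defs "HOL-Computational_Algebra.Fundamental_Theorem_Algebra"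
begin

text \<open>
  By the Leibniz rule the polynomials in question are \<open>g_star d (\<Phi> \<Omega>)\<close>, since \<open>g_star d F\<close> at \<open>x\<close>
  is the \<open>d\<close>-th derivative of \<open>exp (x z) F z\<close> at \<open>z = 0\<close>.

  If \<open>\<Phi>\<close> has only real zeros, the Hadamard product builds \<open>\<Phi> \<Omega>\<close> from \<open>1\<close> by real linear factors,
  factors \<open>exp (b z)\<close> with \<open>b\<close> real, and limits. On \<open>g_star d\<close> a factor \<open>a + b z\<close> acts as
  \<open>p \<mapsto> a p + b p'\<close> and \<open>exp (b z)\<close> as a real translation; both preserve real-rootedness, and so do
  limits, by Hurwitz.  Conversely, the reversed polynomials
  \<open>\<Sum>j\<le>d. (d choose j) e\<^sub>j (z / d)^j\<close> converge to \<open>\<Phi> \<Omega>\<close> locally uniformly, and Hurwitz applies again.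
\<close>

section \<open>Hurwitz's theorem and real zeros\<close>

lemma uniform_limit_bound:
  assumes "\<And>n x. x \<in> S \<Longrightarrow> dist (f n x) (g x) \<le> T n" "T \<longlonglongrightarrow> (0::real)"
  shows "uniform_limit S f g sequentially"
proof (rule uniform_limitI)
  fix e :: real assume "e > 0"
  with assms(2) have "eventually (\<lambda>n. T n < e) sequentially"
    by (rule order_tendstoD)
  then show "\<forall>\<^sub>F n in sequentially. \<forall>x\<in>S. dist (f n x) (g x) < e"
    by eventually_elim (use assms(1) in \<open>auto intro: le_less_trans\<close>)
qed

lemma Hurwitz_only_real_zeros:
  assumes hol: "\<And>n. f n holomorphic_on UNIV" "g holomorphic_on UNIV"
    and lim: "\<And>R. R > 0 \<Longrightarrow> uniform_limit (cball 0 R) f g sequentially"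
    and rz: "\<And>n. f n = (\<lambda>_. 0) \<or> only_real_zeros (f n)"
    and g: "g \<noteq> (\<lambda>_. 0)"
  shows "only_real_zeros g"
proof -
  obtain w where w: "g w \<noteq> 0" using g by auto
  have "(\<lambda>n. f n w) \<longlonglongrightarrow> g w"
    by (rule tendsto_uniform_limitI[OF lim[of "norm w + 1"]]) (auto simp: add_nonneg_pos)
  then have "eventually (\<lambda>n. f n w \<noteq> 0) sequentially"
    by (rule tendsto_imp_eventually_ne) fact
  then obtain N where N: "\<And>n. n \<ge> N \<Longrightarrow> f n w \<noteq> 0"
    by (auto simp: eventually_sequentially)
  have rz': "only_real_zeros (f (n + N))" for n
    using rz[of "n + N"] N[of "n + N"] by auto
  have main: "g z \<noteq> 0"
    if S: "open S" "connected S" "S \<inter> \<real> = {}" "z \<in> S" for S z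
  proof (cases "g constant_on S")
    case True
    then obtain c where c: "\<And>x. x \<in> S \<Longrightarrow> g x = c" by (auto simp: constant_on_def)
    \<comment> \<open>Hurwitz's theorem requires a nonconstant limit. If g is constant on S, the
      identity theorem spreads the value c to the whole plane, so c equals the nonzero
      \<open>g w\<close>.\<close>
    have "g w = c"
      by (rule analytic_continuation_open[of S UNIV "g" "\<lambda>_. c"])
         (use S c hol in \<open>auto intro!: holomorphic_intros\<close>)
    with w c S(4) show ?thesis by auto
  next
    case False
    show ?thesis
    proof (rule Hurwitz_no_zeros[OF S(1,2) _ _ _ False _ S(4), of "\<lambda>n. f (n + N)"])
      show "f (n + N) holomorphic_on S" for n
        using hol holomorphic_on_subset by blast
      show "g holomorphic_on S"
        using hol holomorphic_on_subset by blast
      show "f (n + N) x \<noteq> 0" if "x \<in> S" for n x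
        using rz'[of n] that S(3) by (auto simp: only_real_zeros_def)
      fix K assume K: "compact K" "K \<subseteq> S"
      obtain R where R: "R > 0" "K \<subseteq> cball 0 R"
        using bounded_subset_ballD[OF compact_imp_bounded[OF K(1)], of 0] ball_subset_cball by blast
      have "uniform_limit K f g sequentially"
        using lim[OF R(1)] R(2) by (rule uniform_limit_on_subset)
      then show "uniform_limit K (\<lambda>n. f (n + N)) g sequentially"
        unfolding filterlim_def filtermap_compose[symmetric]
        by (rule filterlim_compose[unfolded filterlim_def, OF _ filterlim_add_const_nat_at_top[unfolded filterlim_def]])
    qed
  qed
  have "Im z = 0" if "g z = 0" for z
  proof (rule ccontr)
    assume "Im z \<noteq> 0"
    then consider "Im z > 0" | "Im z < 0" by linarith
    then show False
    proof cases
      case 1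
      then show False using main[of "{z. Im z > 0}" z] that
        by (auto simp: open_halfspace_Im_gt disjoint_iff complex_is_Real_iff convex_halfspace_Im_gt convex_connected)
    next
      case 2
      then show False using main[of "{z. Im z < 0}" z] that
        by (auto simp: open_halfspace_Im_lt disjoint_iff complex_is_Real_iff convex_halfspace_Im_lt convex_connected)
    qed
  qed
  then show ?thesis by (auto simp: only_real_zeros_def complex_is_Real_iff)
qed

section \<open>Real-rooted polynomials: limits and the operator p \<mapsto> a p + b p'\<close>

lemma poly_only_real_zeros_iff:
  "poly_only_real_zeros p \<longleftrightarrow> poly p = (\<lambda>_. 0) \<or> only_real_zeros (poly p)"
  using poly_eq_poly_eq_iff[of p 0] by (simp add: poly_only_real_zeros_def fun_eq_iff)

text \<open>The common degree bound turns coefficientwise convergence into uniform convergence on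
  discs, so Hurwitz applies even if the degree drops in the limit.\<close>

lemma poly_only_real_zeros_limit:
  assumes deg: "\<And>n. degree (P n) \<le> d" "degree Q \<le> d"
    and lim: "\<And>i. (\<lambda>n. coeff (P n) i) \<longlonglongrightarrow> coeff Q i"
    and rz: "\<And>n. poly_only_real_zeros (P n)"
  shows "poly_only_real_zeros Q"
proof (cases "Q = 0")
  case False
  have poly_eq: "poly p z = (\<Sum>i\<le>d. coeff p i * z ^ i)" if "degree p \<le> d" for p and z :: complex
    unfolding poly_altdef by (rule sum.mono_neutral_left) (use that in \<open>auto simp: coeff_eq_0\<close>)
  have "only_real_zeros (poly Q)"
  proof (rule Hurwitz_only_real_zeros)
    fix R :: real assume "R > 0"
    show "uniform_limit (cball 0 R) (\<lambda>n. poly (P n)) (poly Q) sequentially"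
    proof (rule uniform_limit_bound)
      fix n and z :: complex assume z: "z \<in> cball 0 R"
      have "dist (poly (P n) z) (poly Q z) = norm (\<Sum>i\<le>d. (coeff (P n) i - coeff Q i) * z ^ i)"
        by (simp add: dist_norm poly_eq deg sum_subtractf algebra_simps)
      also have "\<dots> \<le> (\<Sum>i\<le>d. norm (coeff (P n) i - coeff Q i) * R ^ i)"
        by (rule sum_norm_le) (use z in \<open>auto simp: norm_mult norm_power intro!: mult_left_mono power_mono\<close>)
      finally show "dist (poly (P n) z) (poly Q z) \<le> (\<Sum>i\<le>d. norm (coeff (P n) i - coeff Q i) * R ^ i)" .
    next
      show "(\<lambda>n. \<Sum>i\<le>d. norm (coeff (P n) i - coeff Q i) * R ^ i) \<longlonglongrightarrow> 0"
        by (rule tendsto_null_sum) (intro tendsto_mult_left_zero tendsto_norm_zero LIM_zero lim)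
    qed
  next
    show "poly Q \<noteq> (\<lambda>_. 0)"
      using False poly_eq_poly_eq_iff[of Q 0] by (simp add: fun_eq_iff)
  qed (use rz in \<open>auto simp: poly_only_real_zeros_iff intro!: holomorphic_intros\<close>)
  then show ?thesis by (simp add: poly_only_real_zeros_def)
qed (simp add: poly_only_real_zeros_def)

text \<open>The logarithmic derivative is \<open>\<Sum> 1 / (z - r)\<close> over the real roots \<open>r\<close>, and every summand
  lies in the half plane opposite to \<open>z\<close>.\<close>
lemma Im_logderiv_real_roots:
  fixes p :: "complex poly"
  assumes "p \<noteq> 0" "only_real_zeros (poly p)" "Im z \<noteq> 0"
  shows "Im (poly (pderiv p) z / poly p z) * Im z \<le> 0 \<and>
    (degree p > 0 \<longrightarrow> Im (poly (pderiv p) z / poly p z) * Im z < 0)"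
  using assms(1,2)
proof (induction "degree p" arbitrary: p)
  case 0
  then obtain c where "p = [:c:]" by (metis degree_eq_zeroE)
  then show ?case by (simp add: pderiv_pCons)
next
  case (Suc n)
  then have "\<not> constant (poly p)" by (simp add: constant_degree)
  then obtain r where r: "poly p r = 0" using fundamental_theorem_of_algebra by blast
  then have rR: "r \<in> \<real>" using Suc.prems by (auto simp: only_real_zeros_def)
  from r obtain q where q: "p = [:-r, 1:] * q" by (auto simp: poly_eq_0_iff_dvd elim: dvdE)
  have q0: "q \<noteq> 0" using q Suc.prems by auto
  have deg: "n = degree q" using Suc.hyps(2) q q0 by (simp add: degree_mult_eq del: mult_pCons_left)
  have qr: "only_real_zeros (poly q)" using Suc.prems q by (auto simp: only_real_zeros_def)
  have zr: "z \<noteq> r" using rR assms(3) by (auto simp: complex_is_Real_iff)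
  have qz: "poly q z \<noteq> 0" using qr assms(3) by (auto simp: only_real_zeros_def complex_is_Real_iff)
  have "poly (pderiv p) z / poly p z = 1 / (z - r) + poly (pderiv q) z / poly q z"
    unfolding q pderiv_mult using zr qz by (simp add: pderiv_pCons field_simps)
  moreover have "Im (1 / (z - r)) * Im z < 0"
  proof -
    have "Im (1 / (z - r)) * Im z = - (Im z)\<^sup>2 / (norm (z - r))\<^sup>2"
      unfolding Im_divide cmod_power2 using rR by (simp add: complex_is_Real_iff power2_eq_square)
    then show ?thesis using assms(3) zr by (simp add: divide_less_0_iff)
  qed
  ultimately show ?case using Suc.hyps(1)[OF deg q0 qr] by (simp add: distrib_right)
qed

text \<open>At a nonreal zero of a p + b p' the quotient p'/p would be the real number -a/b, but
  \<open>Im_logderiv_real_roots\<close> makes its imaginary part nonzero.\<close>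

lemma poly_only_real_zeros_add_pderiv:
  fixes p :: "complex poly"
  assumes "poly_only_real_zeros p" "a \<in> \<real>" "b \<in> \<real>"
  shows "poly_only_real_zeros (smult a p + smult b (pderiv p))"
proof (cases "p = 0")
  case False
  then have rp: "only_real_zeros (poly p)" using assms(1) by (simp add: poly_only_real_zeros_def)
  show ?thesis
  \<comment> \<open>The main argument divides by b and needs the strict inequality, hence positive
    degree; otherwise the operator is multiplication by a.\<close>
  proof (cases "degree p = 0 \<or> b = 0")
    case True
    then have "smult a p + smult b (pderiv p) = smult a p"
      by (auto elim!: degree_eq_zeroE simp: pderiv_pCons)
    then show ?thesis using rp by (auto simp: poly_only_real_zeros_def only_real_zeros_def)
  next
    case deg: False
    have "Im z = 0" if z: "poly (smult a p + smult b (pderiv p)) z = 0" for z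
    proof (rule ccontr)
      assume Imz: "Im z \<noteq> 0"
      then have "poly p z \<noteq> 0" using rp by (auto simp: only_real_zeros_def complex_is_Real_iff)
      then have "poly (pderiv p) z / poly p z = - (a / b)"
        using z deg by (simp add: field_simps add_eq_0_iff)
      also have "\<dots> \<in> \<real>" using assms by simp
      finally show False
        using Im_logderiv_real_roots[OF False rp Imz] deg by (simp add: complex_is_Real_iff)
    qed
    then show ?thesis
      by (auto simp: poly_only_real_zeros_def only_real_zeros_def complex_is_Real_iff)
  qed
qed (simp add: poly_only_real_zeros_def)

section \<open>Convergence of Jensen polynomials\<close>

lemma falling_factorial_ratio_tendsto:
  "(\<lambda>n. real (n choose j) * fact j / real n ^ j) \<longlonglongrightarrow> 1"
proof -
  have *: "real (n choose j) * fact j / real n ^ j = (\<Prod>i<j. (real n - real i) / real n)" for n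
    by (simp add: binomial_gbinomial gbinomial_prod_rev prod_dividef atLeast0LessThan)
  have "(\<lambda>n. (real n - real i) / real n) \<longlonglongrightarrow> 1" for i
  proof (rule Lim_transform_eventually)
    show "(\<lambda>n. 1 - real i / real n) \<longlonglongrightarrow> 1"
      using tendsto_diff[OF tendsto_const lim_const_over_n[of "real i"], of 1] by simp
    show "\<forall>\<^sub>F n in sequentially. 1 - real i / real n = (real n - real i) / real n"
      using eventually_gt_at_top[of 0] by eventually_elim (simp add: field_simps)
  qed
  then have "(\<lambda>n. \<Prod>i<j. (real n - real i) / real n) \<longlonglongrightarrow> (\<Prod>i<j. 1)"
    by (intro tendsto_prod)
  then show ?thesis by (simp add: *)
qed

text \<open>The n-th Jensen polynomial is the Taylor series with its terms weighted by factors
  \<open>b n j\<close> in [0,1] that tend to 1. The error is at most the sum of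
  \<open>(1 - b n j) * M j\<close>, which does not depend on z and tends to 0 by dominated
  convergence.\<close>

lemma uniform_limit_Jensen_polys:
  fixes e :: "nat \<Rightarrow> complex"
  assumes "summable (\<lambda>j. norm (e j) * R ^ j / fact j)" "R \<ge> 0"
  shows "uniform_limit (cball 0 R)
    (\<lambda>n z. \<Sum>j\<le>n. of_nat (n choose j) * e j * (z / of_nat n) ^ j)
    (\<lambda>z. \<Sum>j. e j * z ^ j / fact j) sequentially"
proof (rule uniform_limit_bound)
  define b where "b n j = real (n choose j) * fact j / real n ^ j" for n j
  define M where "M j = norm (e j) * R ^ j / fact j" for j
  have b: "0 \<le> b n j" "b n j \<le> 1" for n j
  proof -
    have "real ((n choose j) * fact j) \<le> real (n ^ j)"
      using binomial_fact_pow[of n j] of_nat_le_iff by blast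
    then show "b n j \<le> 1" by (simp add: b_def divide_le_eq_1) linarith
  qed (simp add: b_def)
  have M: "summable M" "\<And>j. M j \<ge> 0" using assms by (simp_all add: M_def [abs_def])
  have t: "norm ((1 - b n j) * M j) \<le> M j" for n j
    using b[of n j] M(2)[of j] by (simp add: abs_mult mult_left_le_one_le)
  show "(\<lambda>n. \<Sum>j. (1 - b n j) * M j) \<longlonglongrightarrow> 0"
  proof -
    have "(\<lambda>n. \<Sum>j. (1 - b n j) * M j) \<longlonglongrightarrow> (\<Sum>j. (1 - 1) * M j)"
    proof (intro tannerys_theorem[THEN conjunct2, THEN conjunct2])
      show "(\<lambda>n. (1 - b n k) * M k) \<longlonglongrightarrow> (1 - 1) * M k" for k
        unfolding b_def by (intro tendsto_intros falling_factorial_ratio_tendsto)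
      show "\<forall>\<^sub>F (k, n) in sequentially \<times>\<^sub>F sequentially. norm ((1 - b n k) * M k) \<le> M k"
        using t by (intro always_eventually) auto
    qed (use M in auto)
    then show ?thesis by simp
  qed
  fix n and z :: complex assume z: "z \<in> cball 0 R"
  have nz: "norm (e j * z ^ j / fact j) \<le> M j" for j
    using z by (auto simp: M_def norm_mult norm_divide norm_power intro!: divide_right_mono mult_left_mono power_mono)
  have s1: "summable (\<lambda>j. e j * z ^ j / fact j)"
    by (rule summable_comparison_test'[OF M(1)]) (rule nz)
  have "(\<Sum>j\<le>n. of_nat (n choose j) * e j * (z / of_nat n) ^ j) =
      (\<Sum>j\<le>n. of_real (b n j) * (e j * z ^ j / fact j))"
    by (rule sum.cong) (simp_all add: b_def power_divide)
  \<comment> \<open>For j > n the binomial coefficient in \<open>b n j\<close> vanishes, so the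
    finite sum is a full series.\<close>
  also have s2: "(\<lambda>j. of_real (b n j) * (e j * z ^ j / fact j)) sums \<dots>"
    by (rule sums_finite) (auto simp: b_def)
  then have "(\<Sum>j\<le>n. of_real (b n j) * (e j * z ^ j / fact j)) =
      (\<Sum>j. of_real (b n j) * (e j * z ^ j / fact j))"
    by (simp add: sums_iff)
  finally have "(\<Sum>j\<le>n. of_nat (n choose j) * e j * (z / of_nat n) ^ j) - (\<Sum>j. e j * z ^ j / fact j) =
     - (\<Sum>j. of_real (1 - b n j) * (e j * z ^ j / fact j))"
    using suminf_diff[OF s1 sums_summable[OF s2]] by (simp add: algebra_simps diff_divide_distrib)
  then have "dist (\<Sum>j\<le>n. of_nat (n choose j) * e j * (z / of_nat n) ^ j) (\<Sum>j. e j * z ^ j / fact j) =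
     norm (\<Sum>j. of_real (1 - b n j) * (e j * z ^ j / fact j))"
    by (simp add: dist_norm)
  also have "\<dots> \<le> (\<Sum>j. (1 - b n j) * M j)"
  proof (rule norm_suminf_le)
    show "norm (of_real (1 - b n j) * (e j * z ^ j / fact j)) \<le> (1 - b n j) * M j" for j
      unfolding norm_mult[of "of_real (1 - b n j)"] norm_of_real
      using b[of n j] mult_left_mono[OF nz[of j], of "1 - b n j"] by simp
    show "summable (\<lambda>j. (1 - b n j) * M j)"
      by (rule summable_comparison_test'[OF M(1)]) (rule t)
  qed
  finally show "dist (\<Sum>j\<le>n. of_nat (n choose j) * e j * (z / of_nat n) ^ j) (\<Sum>j. e j * z ^ j / fact j)
    \<le> (\<Sum>j. (1 - b n j) * M j)" .
qed

section \<open>Algebra of the polynomials \<open>g_star\<close>\<close>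

text \<open>Leibniz, since the k-th derivative of exp (x z) at 0 is x^k. In this form, operations on
  F become operations on the polynomial.\<close>

lemma poly_g_star:
  assumes "F holomorphic_on UNIV"
  shows "poly (g_star d F) x = (deriv ^^ d) (\<lambda>z. exp (x * z) * F z) 0"
proof -
  have "(deriv ^^ d) (\<lambda>z. F z * exp (x * z)) 0 =
      (\<Sum>i=0..d. of_nat (d choose i) * (deriv ^^ i) F 0 * (deriv ^^ (d - i)) (\<lambda>z. exp (x * z)) 0)"
    by (rule higher_deriv_mult[of _ UNIV]) (use assms in \<open>auto intro!: holomorphic_intros\<close>)
  moreover have "(deriv ^^ k) (\<lambda>z. exp (x * z)) 0 = x ^ k" for k
  proof -
    have "(deriv ^^ k) exp = (exp :: complex \<Rightarrow> complex)"
      by (induction k) (auto intro!: DERIV_imp_deriv derivative_eq_intros)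
    then show ?thesis
      using higher_deriv_compose_linear[of exp UNIV UNIV 0 x k] by (simp add: holomorphic_on_exp)
  qed
  ultimately show ?thesis
    by (simp add: g_star_def poly_sum poly_monom exp_coeff_def mult.commute[of "exp _"])
qed

text \<open>Leibniz again, with the exponential attached to G.\<close>

lemma poly_g_star_mult:
  assumes "F holomorphic_on UNIV" "G holomorphic_on UNIV"
  shows "poly (g_star d (\<lambda>z. F z * G z)) x =
    (\<Sum>j=0..d. of_nat (d choose j) * exp_coeff F j * poly (g_star (d - j) G) x)"
proof -
  have "poly (g_star d (\<lambda>z. F z * G z)) x = (deriv ^^ d) (\<lambda>z. F z * (exp (x * z) * G z)) 0"
    by (subst poly_g_star) (use assms in \<open>auto intro!: holomorphic_intros simp: mult_ac\<close>)
  also have "\<dots> = (\<Sum>j=0..d. of_nat (d choose j) * (deriv ^^ j) F 0 *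
      (deriv ^^ (d - j)) (\<lambda>z. exp (x * z) * G z) 0)"
    by (rule higher_deriv_mult[of _ UNIV]) (use assms in \<open>auto intro!: holomorphic_intros\<close>)
  finally show ?thesis using assms by (simp add: poly_g_star exp_coeff_def)
qed

lemma g_star_mult:
  assumes "F holomorphic_on UNIV" "G holomorphic_on UNIV"
  shows "g_star d (\<lambda>z. F z * G z) =
    (\<Sum>j=0..d. smult (of_nat (d choose j) * exp_coeff F j) (g_star (d - j) G))"
  using poly_g_star_mult[OF assms] by (intro poly_eq_poly_eq_iff[THEN iffD1] ext) (simp add: poly_sum)

lemma coeff_g_star:
  "coeff (g_star d F) i = (if i \<le> d then of_nat (d choose i) * exp_coeff F (d - i) else 0)"
proof -
  have "coeff (g_star d F) i = (\<Sum>j=0..d. if d - j = i then of_nat (d choose j) * exp_coeff F j else 0)"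
    by (simp add: g_star_def coeff_sum)
  also have "\<dots> = (\<Sum>j=0..d. if j = d - i then (if i \<le> d then of_nat (d choose j) * exp_coeff F j else 0) else 0)"
    by (rule sum.cong) auto
  also have "\<dots> = (if i \<le> d then of_nat (d choose i) * exp_coeff F (d - i) else 0)"
    by (simp add: binomial_symmetric[symmetric])
  finally show ?thesis .
qed

lemma degree_g_star: "degree (g_star d F) \<le> d"
  by (rule degree_le) (simp add: coeff_g_star)

text \<open>The Appell property, which lets multiplication of F by z appear as differentiation. For
  d = 0 the factor d makes the truncated index d - 1 harmless.\<close>

lemma pderiv_g_star: "pderiv (g_star d F) = smult (of_nat d) (g_star (d - 1) F)"
proof (cases d)
  case (Suc n)
  have "Suc i * (Suc n choose Suc i) = Suc n * (n choose i)" for i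
    using Suc_times_binomial[of i n] by simp
  then have "of_nat (Suc i) * of_nat (Suc n choose Suc i) = (of_nat (Suc n) * of_nat (n choose i) :: complex)" for i
    by (metis of_nat_mult)
  then show ?thesis
    by (intro poly_eqI)
       (simp add: Suc coeff_pderiv coeff_g_star mult.assoc[symmetric] del: of_nat_Suc binomial_Suc_Suc)
qed (simp add: g_star_def pderiv_monom monom_0 pderiv_pCons)

section \<open>Functions with real-rooted Jensen polynomials: closure properties\<close>

text \<open>\<open>g_star d F\<close> is the reversed Jensen polynomial of F. Coefficients may be
  complex, so the class is closed under complex scalars.\<close>

definition real_jensen :: "(complex \<Rightarrow> complex) \<Rightarrow> bool" where
  "real_jensen F \<longleftrightarrow> F holomorphic_on UNIV \<and> (\<forall>d. poly_only_real_zeros (g_star d F))"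

lemma real_jensen_holomorphic: "real_jensen F \<Longrightarrow> F holomorphic_on A"
  unfolding real_jensen_def using holomorphic_on_subset by blast

lemma real_jensen_cmult:
  assumes "real_jensen F"
  shows "real_jensen (\<lambda>z. c * F z)"
proof -
  have hol: "F holomorphic_on UNIV" using assms by (rule real_jensen_holomorphic)
  have "g_star d (\<lambda>z. c * F z) = smult c (g_star d F)" for d
    by (rule poly_eqI) (simp add: coeff_g_star exp_coeff_def higher_deriv_cmult[OF hol])
  then show ?thesis
    using assms by (auto simp: real_jensen_def poly_only_real_zeros_def only_real_zeros_def intro!: holomorphic_intros)
qed

text \<open>Only the Leibniz terms j = 0 and j = 1 survive; by the Appell property they form a p + b
  p'.\<close>

lemma real_jensen_mult_linear:
  assumes "real_jensen F" "a \<in> \<real>" "b \<in> \<real>"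
  shows "real_jensen (\<lambda>z. (a + b * z) * F z)"
proof -
  have hol: "F holomorphic_on UNIV" using assms(1) by (rule real_jensen_holomorphic)
  have lin: "exp_coeff (\<lambda>z. a + b * z) j = (if j = 0 then a else if j = 1 then b else 0)" for j
  proof -
    have "exp_coeff (\<lambda>z. a + b * z) j = (deriv ^^ j) (\<lambda>z. a) 0 + (deriv ^^ j) (\<lambda>z. b * z) 0"
      unfolding exp_coeff_def
      by (rule higher_deriv_add[of _ UNIV]) (auto intro!: holomorphic_intros)
    then show ?thesis by auto
  qed
  have "g_star d (\<lambda>z. (a + b * z) * F z) = smult a (g_star d F) + smult b (pderiv (g_star d F))" for d
  proof -
    have "g_star d (\<lambda>z. (a + b * z) * F z) =
        (\<Sum>j=0..d. smult (of_nat (d choose j) * exp_coeff (\<lambda>z. a + b * z) j) (g_star (d - j) F))"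
      by (rule g_star_mult) (use hol in \<open>auto intro!: holomorphic_intros\<close>)
    also have "\<dots> = (\<Sum>j\<in>{0..d}\<inter>{0,1}. smult (of_nat (d choose j) * exp_coeff (\<lambda>z. a + b * z) j) (g_star (d - j) F))"
      by (rule sum.mono_neutral_right) (auto simp: lin)
    \<comment> \<open>For d = 0 the term j = 1 is absent, in agreement with the vanishing derivative
      of a constant.\<close>
    also have "{0..d}\<inter>{0,1} = (if d = 0 then {0} else {0,1})" by auto
    also have "(\<Sum>j\<in>\<dots>. smult (of_nat (d choose j) * exp_coeff (\<lambda>z. a + b * z) j) (g_star (d - j) F)) =
        smult a (g_star d F) + smult b (pderiv (g_star d F))"
      by (auto simp: lin pderiv_g_star mult.commute[of "of_nat d"])
    finally show ?thesis .
  qed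
  then show ?thesis
    using assms poly_only_real_zeros_add_pderiv
    by (auto simp: real_jensen_def intro!: holomorphic_intros)
qed

text \<open>As exp (x z) exp (b z) = exp ((x + b) z), the polynomial is merely translated by the
  real number b.\<close>

lemma real_jensen_mult_exp:
  assumes "real_jensen F" "b \<in> \<real>"
  shows "real_jensen (\<lambda>z. exp (b * z) * F z)"
proof -
  have hol: "F holomorphic_on UNIV" using assms(1) by (rule real_jensen_holomorphic)
  have "poly (g_star d (\<lambda>z. exp (b * z) * F z)) x = poly (g_star d F) (x + b)" for d x
    by (subst (1 2) poly_g_star) (auto intro!: holomorphic_intros hol simp: exp_add algebra_simps)
  then have "poly_only_real_zeros (g_star d (\<lambda>z. exp (b * z) * F z))" for d
    using assms unfolding real_jensen_def poly_only_real_zeros_iff only_real_zeros_def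
    by (metis add_diff_cancel_right' Reals_diff)
  then show ?thesis
    using hol by (auto simp: real_jensen_def intro!: holomorphic_intros)
qed

text \<open>Uniform convergence near 0 passes to all derivatives at 0, that is, to the coefficients
  of each \<open>g_star d\<close>, whose degree stays at most d.\<close>

lemma real_jensen_limit:
  assumes "\<And>n. real_jensen (F n)" "uniform_limit (cball 0 1) F G sequentially" "G holomorphic_on UNIV"
  shows "real_jensen G"
proof -
  have lim: "(\<lambda>n. exp_coeff (F n) j) \<longlonglongrightarrow> exp_coeff G j" for j
    unfolding exp_coeff_def
  proof (rule higher_deriv_complex_uniform_limit)
    show "uniform_limit (ball 0 1) F G sequentially"
      using assms(2) by (rule uniform_limit_on_subset) auto
  qed (use assms(1) real_jensen_holomorphic in auto)
  have "poly_only_real_zeros (g_star d G)" for d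
  proof (rule poly_only_real_zeros_limit[where d = d])
    show "(\<lambda>n. coeff (g_star d (F n)) i) \<longlonglongrightarrow> coeff (g_star d G) i" for i
      by (simp add: coeff_g_star tendsto_mult_left lim)
  qed (use assms(1) in \<open>auto simp: degree_g_star real_jensen_def\<close>)
  then show ?thesis using assms(3) by (simp add: real_jensen_def)
qed

lemma real_jensen_mult_limit:
  assumes "\<And>n. real_jensen (\<lambda>z. P n z * F z)" "uniform_limit (cball 0 1) P Q sequentially"
    "Q holomorphic_on UNIV" "F holomorphic_on UNIV"
  shows "real_jensen (\<lambda>z. Q z * F z)"
proof (rule real_jensen_limit[OF assms(1)])
  have "bounded (h ` cball 0 1)" if "h holomorphic_on UNIV" for h :: "complex \<Rightarrow> complex"
    using that
    by (intro compact_imp_bounded compact_continuous_image holomorphic_on_imp_continuous_on)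
       (auto intro: holomorphic_on_subset)
  then show "uniform_limit (cball 0 1) (\<lambda>n z. P n z * F z) (\<lambda>z. Q z * F z) sequentially"
    using assms by (intro uniform_lim_mult uniform_limit_const) auto
  show "(\<lambda>z. Q z * F z) holomorphic_on UNIV"
    using assms by (auto intro!: holomorphic_intros)
qed

text \<open>The powers are the Jensen polynomials of exp, by the binomial theorem.\<close>

lemma uniform_limit_exp_powers:
  assumes "R \<ge> 0"
  shows "uniform_limit (cball 0 R) (\<lambda>n z. (1 + z / of_nat n) ^ n) (exp :: complex \<Rightarrow> complex) sequentially"
proof -
  have "uniform_limit (cball 0 R) (\<lambda>n z. \<Sum>j\<le>n. of_nat (n choose j) * 1 * (z / of_nat n) ^ j)
      (\<lambda>z. \<Sum>j. 1 * z ^ j / (fact j :: complex)) sequentially"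
    by (rule uniform_limit_Jensen_polys) (use assms summable_exp[of R] in \<open>auto simp: divide_inverse mult.commute\<close>)
  moreover have "(\<Sum>j. 1 * z ^ j / (fact j :: complex)) = exp z" for z
    by (simp add: exp_def scaleR_conv_of_real divide_inverse mult.commute)
  moreover have "(\<Sum>j\<le>n. of_nat (n choose j) * 1 * (z / of_nat n) ^ j) = (1 + z / of_nat n) ^ n"
    for n and z :: complex
    using binomial_ring[of "z / of_nat n" 1 n] by (simp add: add.commute)
  ultimately show ?thesis by simp
qed

text \<open>The Gaussian is the limit of (1 - \<alpha> z^2 / n)^n, and each base splits into two
  real linear factors.\<close>

lemma real_jensen_mult_gauss:
  assumes "real_jensen F" "\<alpha> \<ge> 0"
  shows "real_jensen (\<lambda>z. exp (- of_real \<alpha> * z ^ 2) * F z)"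
proof (rule real_jensen_mult_limit)
  have step: "real_jensen (\<lambda>z. (1 + (- of_real \<alpha> * z ^ 2) / of_nat n) * G z)" if "real_jensen G" for G n
  proof -
    \<comment> \<open>s is real because \<alpha> \<ge> 0; the factors are 1 + s z and 1 - s z. For n
      = 0 division by zero makes s = 0, and both equal 1.\<close>
    define s where "s = complex_of_real (sqrt (\<alpha> / real n))"
    have "s ^ 2 = of_real \<alpha> / of_nat n"
      using assms(2) by (simp add: s_def flip: of_real_power)
    then have "1 + (- of_real \<alpha> * z ^ 2) / of_nat n = 1 - s ^ 2 * z ^ 2" for z
      by simp
    then have "(1 + (- of_real \<alpha> * z ^ 2) / of_nat n) * G z = (1 + s * z) * ((1 + (-s) * z) * G z)" for z
      by (simp only:) (simp add: algebra_simps power2_eq_square)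
    then show ?thesis
      using that by (simp only:) (intro real_jensen_mult_linear; simp add: s_def)
  qed
  show "real_jensen (\<lambda>z. (1 + (- of_real \<alpha> * z ^ 2) / of_nat n) ^ n * F z)" for n
  proof -
    have "real_jensen (\<lambda>z. (1 + (- of_real \<alpha> * z ^ 2) / of_nat n) ^ k * F z)" for k
    proof (induction k)
      case (Suc k)
      from step[OF this, of n] show ?case by (simp only: power_Suc mult.assoc)
    qed (use assms in simp)
    then show ?thesis .
  qed
  show "uniform_limit (cball 0 1) (\<lambda>n z :: complex. (1 + (- of_real \<alpha> * z ^ 2) / of_nat n) ^ n)
      (\<lambda>z. exp (- of_real \<alpha> * z ^ 2)) sequentially"
  proof -
    have "- of_real \<alpha> * z ^ 2 \<in> cball 0 \<alpha>" if "z \<in> cball 0 1" for z :: complex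
      using that assms(2) by (simp add: norm_mult norm_power mult_left_le power_le_one)
    then show ?thesis
      using uniform_limit_exp_powers[OF assms(2)]
      unfolding uniform_limit_iff by (blast intro: eventually_mono)
  qed
qed (use assms(1) real_jensen_holomorphic in \<open>auto intro!: holomorphic_intros\<close>)

section \<open>Weierstrass products\<close>

text \<open>The majorant for the M-test. For large n either \<open>a n\<close> is the padding value
  0, where both sides vanish, or |a n| > 2 R.\<close>

lemma weierstrass_factor_summable_bound:
  fixes a :: "nat \<Rightarrow> complex"
  assumes "summable (\<lambda>n. 1 / norm (a n) ^ (p + 1))" "R \<ge> 0"
  shows "\<forall>\<^sub>F n in sequentially. \<forall>z\<in>cball 0 R.
    norm (weierstrass_factor p (z / a n) - 1) \<le> 3 * R ^ (p + 1) * (1 / norm (a n) ^ (p + 1))"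
proof -
  have "(\<lambda>n. R ^ (p + 1) * (1 / norm (a n) ^ (p + 1))) \<longlonglongrightarrow> R ^ (p + 1) * 0"
    by (intro tendsto_intros summable_LIMSEQ_zero assms)
  \<comment> \<open>Taking (p+1)-th roots of this threshold gives |z / a n| \<le> 1/2, the range of
    \<open>weierstrass_factor_bound\<close>.\<close>
  then have "\<forall>\<^sub>F n in sequentially. R ^ (p + 1) * (1 / norm (a n) ^ (p + 1)) < (1 / 2) ^ (p + 1)"
    by (rule order_tendstoD) simp
  then show ?thesis
  proof eventually_elim
    case (elim n)
    show ?case
    proof
      fix z :: complex assume z: "z \<in> cball 0 R"
      have le: "norm (z / a n) \<le> R / norm (a n)"
        using z by (simp add: norm_divide divide_right_mono)
      have "(R / norm (a n)) ^ Suc p \<le> (1 / 2) ^ Suc p"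
        using elim by (simp add: power_divide)
      then have "R / norm (a n) \<le> 1 / 2"
        by (rule power_le_imp_le_base) simp
      with le have "norm (weierstrass_factor p (z / a n) - 1) \<le> 3 * norm (z / a n) ^ Suc p"
        by (intro weierstrass_factor_bound) (rule order_trans)
      also have "\<dots> \<le> 3 * (R / norm (a n)) ^ Suc p"
        by (intro mult_left_mono power_mono le) auto
      finally show "norm (weierstrass_factor p (z / a n) - 1) \<le> 3 * R ^ (p + 1) * (1 / norm (a n) ^ (p + 1))"
        by (simp add: power_divide)
    qed
  qed
qed

lemma weierstrass_has_prod:
  fixes a :: "nat \<Rightarrow> complex"
  assumes "summable (\<lambda>n. 1 / norm (a n) ^ (p + 1))"
  shows "(\<lambda>n. weierstrass_factor p (z / a n)) has_prod (\<Prod>n. weierstrass_factor p (z / a n))"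
proof -
  have "summable (\<lambda>n. norm (weierstrass_factor p (z / a n) - 1))"
  proof (rule summable_comparison_test_ev)
    show "\<forall>\<^sub>F n in sequentially. norm (norm (weierstrass_factor p (z / a n) - 1))
        \<le> 3 * norm z ^ (p + 1) * (1 / norm (a n) ^ (p + 1))"
      using weierstrass_factor_summable_bound[OF assms norm_ge_zero[of z]]
      by eventually_elim auto
  qed (intro summable_mult assms)
  then show ?thesis
    using abs_convergent_prod_conv_summable abs_convergent_prod_imp_convergent_prod by blast
qed

lemma weierstrass_uniform_limit:
  fixes a :: "nat \<Rightarrow> complex"
  assumes "summable (\<lambda>n. 1 / norm (a n) ^ (p + 1))" "R \<ge> 0"
  shows "uniform_limit (cball 0 R) (\<lambda>N z. \<Prod>n<N. weierstrass_factor p (z / a n))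
    (\<lambda>z. \<Prod>n. weierstrass_factor p (z / a n)) sequentially"
proof -
  have "uniformly_convergent_on (cball 0 R) (\<lambda>N z. \<Prod>n<N. weierstrass_factor p (z / a n))"
  proof (rule uniformly_convergent_on_prod')
    show "uniformly_convergent_on (cball 0 R) (\<lambda>N z. \<Sum>n<N. norm (weierstrass_factor p (z / a n) - 1))"
    proof (rule Weierstrass_m_test'_ev)
      show "\<forall>\<^sub>F n in sequentially. \<forall>z\<in>cball 0 R. norm (norm (weierstrass_factor p (z / a n) - 1))
          \<le> 3 * R ^ (p + 1) * (1 / norm (a n) ^ (p + 1))"
        using weierstrass_factor_summable_bound[OF assms] by simp
    qed (intro summable_mult assms)
  qed (auto simp: divide_inverse intro!: continuous_intros)
  then obtain g where g: "uniform_limit (cball 0 R) (\<lambda>N z. \<Prod>n<N. weierstrass_factor p (z / a n)) g sequentially"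
    by (auto simp: uniformly_convergent_on_def)
  \<comment> \<open>The M-test only yields some uniform limit; pointwise it must be the infinite
    product.\<close>
  have "g z = (\<Prod>n. weierstrass_factor p (z / a n))" if "z \<in> cball 0 R" for z
    using tendsto_uniform_limitI[OF g that] has_prod_imp_tendsto'[OF weierstrass_has_prod[OF assms(1), of z]]
    by (rule LIMSEQ_unique)
  then have "?thesis \<longleftrightarrow> uniform_limit (cball 0 R) (\<lambda>N z. \<Prod>n<N. weierstrass_factor p (z / a n)) g sequentially"
    by (intro uniform_limit_cong') auto
  with g show ?thesis by simp
qed

lemma weierstrass_product_holomorphic:
  fixes a :: "nat \<Rightarrow> complex"
  assumes "summable (\<lambda>n. 1 / norm (a n) ^ (p + 1))"
  shows "(\<lambda>z. \<Prod>n. weierstrass_factor p (z / a n)) holomorphic_on UNIV"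
proof (rule holomorphic_uniform_sequence[OF open_UNIV])
  show "(\<lambda>z. \<Prod>n<N. weierstrass_factor p (z / a n)) holomorphic_on UNIV" for N
    by (auto simp: divide_inverse intro!: holomorphic_intros)
  fix x :: complex
  have "cball x 1 \<subseteq> cball 0 (norm x + 1)"
    by (auto simp: dist_norm) (metis norm_minus_commute norm_triangle_sub order_trans add_le_cancel_left)
  then show "\<exists>d>0. cball x d \<subseteq> UNIV \<and> uniform_limit (cball x d)
      (\<lambda>N z. \<Prod>n<N. weierstrass_factor p (z / a n)) (\<lambda>z. \<Prod>n. weierstrass_factor p (z / a n)) sequentially"
    by (intro exI[of _ 1] conjI uniform_limit_on_subset[OF weierstrass_uniform_limit[OF assms]]) auto
qed

text \<open>The product is continuous with value 1 at 0, since no factor has a zero there.\<close>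

lemma weierstrass_product_nonzero_near_0:
  fixes a :: "nat \<Rightarrow> complex"
  assumes "summable (\<lambda>n. 1 / norm (a n) ^ (p + 1))"
  obtains \<delta> where "\<delta> > 0" "\<And>z. norm z < \<delta> \<Longrightarrow> (\<Prod>n. weierstrass_factor p (z / a n)) \<noteq> 0"
proof -
  have "isCont (\<lambda>z. \<Prod>n. weierstrass_factor p (z / a n)) 0"
    using holomorphic_on_imp_continuous_on[OF weierstrass_product_holomorphic[OF assms]]
    by (simp add: continuous_on_eq_continuous_at)
  then have "((\<lambda>z. \<Prod>n. weierstrass_factor p (z / a n)) \<longlongrightarrow> (\<Prod>n. weierstrass_factor p (0 / a n))) (nhds 0)"
    using tendsto_at_iff_tendsto_nhds[of "\<lambda>z. \<Prod>n. weierstrass_factor p (z / a n)" 0]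
    by (simp only: isCont_def)
  then have "\<forall>\<^sub>F z in nhds 0. (\<Prod>n. weierstrass_factor p (z / a n)) \<noteq> 0"
    by (rule tendsto_imp_eventually_ne) simp
  then show ?thesis
    using that by (auto simp: eventually_nhds_metric)
qed

section \<open>Factorization of functions of genus 1*\<close>

text \<open>Q has degree at most 1, so its exponential splits into a constant and exp (q1 z). The
  nesting lets the factors be treated one at a time.\<close>

lemma genus_one_starE:
  assumes "genus_one_star F"
  obtains \<alpha> :: real and m p a q0 q1 where "\<alpha> \<ge> 0" "p \<le> 1" "summable (\<lambda>n. 1 / norm (a n) ^ (p + 1))"
    "\<And>z. F z = exp (- of_real \<alpha> * z ^ 2) * (exp q0 * (exp (q1 * z) * (z ^ m * (\<Prod>n. weierstrass_factor p (z / a n)))))"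
proof -
  obtain \<alpha> f h where *: "\<alpha> \<ge> 0" "h \<le> 1" "has_genus f h"
      "\<And>z. F z = exp (- of_real \<alpha> * z ^ 2) * f z"
    using assms by (auto simp: genus_one_star_def)
  then obtain m Q a p where f: "summable (\<lambda>n. 1 / norm (a n) ^ (p + 1))"
      "\<And>z. f z = z ^ m * exp (poly Q z) * (\<Prod>n. weierstrass_factor p (z / a n))" "h = max p (degree Q)"
    unfolding has_genus_def by blast
  have "degree Q \<le> 1" using *(2) f(3) by simp
  then have Q: "poly Q z = coeff Q 0 + coeff Q 1 * z" for z
    by (cases "degree Q") (auto simp: poly_altdef coeff_eq_0)
  show ?thesis
    by (rule that[OF *(1) _ f(1), of "coeff Q 0" "coeff Q 1" m])
       (use *(2) f(3) in \<open>auto simp: *(4) f(2) Q exp_add mult_ac\<close>)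
qed

lemma genus_one_star_nonzero_near_0:
  assumes "genus_one_star F"
  obtains \<delta> where "\<delta> > 0" "\<And>z. z \<noteq> 0 \<Longrightarrow> norm z < \<delta> \<Longrightarrow> F z \<noteq> 0"
  using assms
proof (cases rule: genus_one_starE)
  case (1 \<alpha> m p a q0 q1)
  then show ?thesis
    using weierstrass_product_nonzero_near_0[OF 1(3)] that by (metis exp_not_eq_zero mult_eq_0_iff power_not_zero)
qed

text \<open>Dividing the values at 2 s and s removes c and leaves exp (q s) real. So Im q * s is a
  multiple of pi, impossible for small s > 0 unless Im q = 0.\<close>

lemma exp_linear_real_near_0:
  fixes c q :: complex
  assumes "\<delta> > 0" "\<And>x::real. 0 < x \<Longrightarrow> x < \<delta> \<Longrightarrow> exp (c + q * of_real x) \<in> \<real>"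
  shows "q \<in> \<real>"
proof (rule ccontr)
  assume "q \<notin> \<real>"
  then have q: "\<bar>Im q\<bar> > 0" by (simp add: complex_is_Real_iff)
  \<comment> \<open>Small enough that s and 2 s lie below \<delta> and that |Im q| s \<le> 1 <
    pi.\<close>
  define s where "s = min (\<delta> / 4) (1 / \<bar>Im q\<bar>)"
  have s: "s > 0" "2 * s < \<delta>" "\<bar>Im q\<bar> * s \<le> 1"
    using assms(1) q by (auto simp: s_def min_def field_simps)
  have "exp (q * of_real s) = exp (c + q * of_real (2 * s)) / exp (c + q * of_real s)"
    by (simp add: exp_diff[symmetric] algebra_simps)
  also have "\<dots> \<in> \<real>"
    using s by (intro Reals_divide assms(2)) auto
  finally have "sin (Im q * s) = 0"
    by (simp add: complex_is_Real_iff Im_exp)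
  moreover have "\<bar>Im q * s\<bar> < pi" using s pi_gt3 by (simp add: abs_mult)
  then have "- pi < Im q * s" "Im q * s < pi" by linarith+
  ultimately have "Im q * s = 0"
    by (metis sin_eq_0_pi)
  then show False using s(1) q by simp
qed

section \<open>Multiplication by Laguerre-Polya functions\<close>

text \<open>The factor is 1 - z/a, times exp (z/a) if p = 1. For the padding value a = 0 both become
  1, as \<open>inverse 0 = 0\<close>.\<close>

lemma real_jensen_mult_weierstrass_factor:
  assumes "real_jensen F" "p \<le> 1" "a \<in> \<real>"
  shows "real_jensen (\<lambda>z. weierstrass_factor p (z / a) * F z)"
proof -
  have lin: "real_jensen (\<lambda>z. (1 + (- inverse a) * z) * F z)"
    by (rule real_jensen_mult_linear) (use assms in auto)
  from \<open>p \<le> 1\<close> consider "p = 0" | "p = 1" by linarith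
  then show ?thesis
  proof cases
    case 1
    then show ?thesis using lin by (simp add: weierstrass_factor_def mult_ac divide_inverse)
  next
    case 2
    have "real_jensen (\<lambda>z. exp (inverse a * z) * ((1 + (- inverse a) * z) * F z))"
      by (rule real_jensen_mult_exp[OF lin]) (use assms(3) in simp)
    then show ?thesis using 2 by (simp add: weierstrass_factor_def mult_ac divide_inverse)
  qed
qed

lemma real_jensen_mult_laguerre_polya:
  assumes "real_jensen G" "laguerre_polya F"
  shows "real_jensen (\<lambda>z. F z * G z)"
proof -
  have F: "real_entire F" "genus_one_star F" "only_real_zeros F"
    using assms(2) by (auto simp: laguerre_polya_def)
  from F(2) show ?thesis
  proof (cases rule: genus_one_starE)
    case (1 \<alpha> m p a q0 q1)
    define P where "P z = (\<Prod>n. weierstrass_factor p (z / a n))" for z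
    note F_eq = 1(4)[folded P_def]
    \<comment> \<open>A nonzero \<open>a n\<close> is a zero of F, hence real; the padding value 0
      is real anyway.\<close>
    have aR: "a n \<in> \<real>" for n
    proof (cases "a n = 0")
      case False
      then have "P (a n) = 0"
        unfolding P_def by (intro has_prod_zeroI[OF weierstrass_has_prod[OF 1(3)], where n = n]) simp
      then have "F (a n) = 0" by (simp add: F_eq)
      then show ?thesis using F(3) by (simp add: only_real_zeros_def)
    qed simp
    have wR: "weierstrass_factor p (of_real x / a n) \<in> \<real>" for x n
      using aR[of n] by (auto simp: weierstrass_factor_def intro!: Reals_mult exp_in_Reals sum_in_Reals)
    have PR: "P (of_real x) \<in> \<real>" for x
    proof -
      have "(\<lambda>N. \<Prod>n<N. weierstrass_factor p (of_real x / a n)) \<longlonglongrightarrow> P (of_real x)"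
        unfolding P_def by (rule has_prod_imp_tendsto'[OF weierstrass_has_prod[OF 1(3)]])
      then show ?thesis
        by (rule closed_sequentially[OF closed_complex_Reals, rotated]) (auto intro: wR prod_in_Reals)
    qed
    obtain \<delta> where \<delta>: "\<delta> > 0" "\<And>z. norm z < \<delta> \<Longrightarrow> P z \<noteq> 0"
      using weierstrass_product_nonzero_near_0[OF 1(3)] unfolding P_def by blast
    \<comment> \<open>On a short interval to the right of 0, F is real and t, the product of the
      remaining factors, is real and nonzero, so their quotient exp (q0 + q1 x) is real.\<close>
    have "q1 \<in> \<real>"
    proof (rule exp_linear_real_near_0[OF \<delta>(1), where c = q0])
      fix x :: real assume x: "0 < x" "x < \<delta>"
      define t where "t = exp (- of_real \<alpha> * of_real x ^ 2) * (of_real x ^ m * P (of_real x))"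
      have "t \<in> \<real>" unfolding t_def using PR by (auto intro!: Reals_mult exp_in_Reals Reals_power)
      moreover have "t \<noteq> 0" unfolding t_def using x \<delta>(2)[of "of_real x"] by simp
      moreover have "F (of_real x) = t * exp (q0 + q1 * of_real x)"
        by (simp add: F_eq t_def exp_add mult_ac)
      ultimately have "exp (q0 + q1 * of_real x) = F (of_real x) / t" by simp
      also have "\<dots> \<in> \<real>" using F(1) \<open>t \<in> \<real>\<close> by (simp add: real_entire_def)
      finally show "exp (q0 + q1 * of_real x) \<in> \<real>" .
    qed
    have J: "real_jensen (\<lambda>z. P z * G z)"
    proof (rule real_jensen_mult_limit)
      show "uniform_limit (cball 0 1) (\<lambda>N z. \<Prod>n<N. weierstrass_factor p (z / a n)) P sequentially"
        using weierstrass_uniform_limit[OF 1(3), of 1] by (simp add: P_def[abs_def])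
      show "P holomorphic_on UNIV"
        using weierstrass_product_holomorphic[OF 1(3)] by (simp add: P_def[abs_def])
      show "G holomorphic_on UNIV" using assms(1) by (rule real_jensen_holomorphic)
      show "real_jensen (\<lambda>z. (\<Prod>n<N. weierstrass_factor p (z / a n)) * G z)" for N
      proof (induction N)
        case (Suc N)
        from real_jensen_mult_weierstrass_factor[OF this 1(2) aR[of N]] show ?case
          by (simp add: mult_ac)
      qed (use assms in simp)
    qed
    have "real_jensen (\<lambda>z. z ^ m * (P z * G z))"
    proof (induction m)
      case (Suc m)
      from real_jensen_mult_linear[OF this, of 0 1] show ?case by (simp add: mult_ac)
    qed (use J in simp)
    \<comment> \<open>The constant exp q0 may be complex; it enters as a scalar.\<close>
    from real_jensen_mult_gauss[OF real_jensen_cmult[OF real_jensen_mult_exp[OF this \<open>q1 \<in> \<real>\<close>], of "exp q0"] 1(1)]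
    show ?thesis by (simp add: F_eq mult_ac)
  qed
qed

lemma real_jensen_1: "real_jensen (\<lambda>_. 1)"
proof -
  have "g_star d (\<lambda>_. 1) = monom 1 d" for d
  proof (rule poly_eqI)
    have "exp_coeff (\<lambda>_. 1) j = (if j = 0 then 1 else 0)" for j
      by (cases j) (auto simp: exp_coeff_def)
    then show "coeff (g_star d (\<lambda>_. 1)) i = coeff (monom 1 d) i" for i
      by (auto simp: coeff_g_star)
  qed
  then show ?thesis
    by (auto simp: real_jensen_def poly_only_real_zeros_def only_real_zeros_def poly_monom)
qed

section \<open>From Jensen polynomials back to the function\<close>

lemma only_real_zeros_if_real_jensen:
  assumes "real_jensen F" "F \<noteq> (\<lambda>_. 0)"
  shows "only_real_zeros F"
proof -
  define e where "e = exp_coeff F"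
  have hol: "F holomorphic_on UNIV" using assms(1) by (rule real_jensen_holomorphic)
  have sums: "(\<lambda>j. e j * z ^ j / fact j) sums F z" for z
    unfolding e_def by (rule exp_coeff_sums[OF hol])
  define J where "J n z = (\<Sum>j\<le>n. of_nat (n choose j) * e j * (z / of_nat n) ^ j)" for n z
  text \<open>\<open>J n\<close> is the reversal of \<open>g_star n F\<close>, with the variable scaled by \<open>1 / n\<close>.\<close>
  have J_eq: "J n z = (z / of_nat n) ^ n * poly (g_star n F) (of_nat n / z)" if "z \<noteq> 0" "n > 0" for n z
  proof -
    have "(z / of_nat n) ^ n * poly (g_star n F) (of_nat n / z) =
      (\<Sum>j\<le>n. of_nat (n choose j) * e j * ((z / of_nat n) ^ n * (of_nat n / z) ^ (n - j)))"
      by (simp add: g_star_def poly_sum poly_monom e_def sum_distrib_left mult_ac atLeast0AtMost)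
    also have "\<dots> = J n z"
      unfolding J_def
    proof (intro sum.cong refl)
      fix j assume "j \<in> {..n}"
      then have "(z / of_nat n) ^ n = (z / of_nat n) ^ j * (z / of_nat n) ^ (n - j)"
        by (simp flip: power_add)
      then have "(z / of_nat n) ^ n * (of_nat n / z) ^ (n - j) = (z / of_nat n) ^ j"
        using that by (simp add: power_mult_distrib[symmetric])
      then show "of_nat (n choose j) * e j * ((z / of_nat n) ^ n * (of_nat n / z) ^ (n - j)) =
          of_nat (n choose j) * e j * (z / of_nat n) ^ j" by simp
    qed
    finally show ?thesis by simp
  qed
  show ?thesis
  proof (rule Hurwitz_only_real_zeros[OF _ hol _ _ assms(2)])
    show "J n holomorphic_on UNIV" for n
      unfolding J_def[abs_def] divide_inverse by (intro holomorphic_intros)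
    fix R :: real assume "R > 0"
    \<comment> \<open>Convergence at the larger radius R + 1 gives absolute convergence at
      R.\<close>
    have "summable (\<lambda>j. norm (e j / fact j * of_real R ^ j))"
    proof (rule powser_insidea)
      show "summable (\<lambda>j. e j / fact j * of_real (R + 1) ^ j)"
        using sums_summable[OF sums[of "of_real (R + 1)"]] by simp
    qed (use \<open>R > 0\<close> in auto)
    then have "summable (\<lambda>j. norm (e j) * R ^ j / fact j)"
      using \<open>R > 0\<close> by (simp add: norm_mult norm_divide norm_power)
    from uniform_limit_Jensen_polys[OF this] \<open>R > 0\<close>
    show "uniform_limit (cball 0 R) J F sequentially"
      using sums by (simp add: J_def[abs_def] sums_iff)
  next
    fix n
    show "J n = (\<lambda>_. 0) \<or> only_real_zeros (J n)"
    proof (cases "n = 0")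
      case True
      then have "J n = (\<lambda>_. e 0)" by (simp add: J_def[abs_def])
      then show ?thesis by (auto simp: only_real_zeros_def)
    next
      case False
      consider "g_star n F = 0" | "only_real_zeros (poly (g_star n F))"
        using assms(1) by (auto simp: real_jensen_def poly_only_real_zeros_def)
      then show ?thesis
      proof cases
        case 1
        \<comment> \<open>The binomial coefficients are nonzero for j \<le> n, so a zero
          \<open>g_star n F\<close> forces \<open>J n\<close> to vanish identically.\<close>
        have "e j = 0" if "j \<le> n" for j
        proof -
          have "coeff (g_star n F) (n - j) = 0" using 1 by simp
          then show ?thesis using that by (auto simp: coeff_g_star e_def)
        qed
        then show ?thesis by (simp add: J_def[abs_def])
      next
        case 2
        \<comment> \<open>Nonzero zeros of \<open>J n\<close> have the form n / x with x a zero of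
          \<open>g_star n F\<close>; x is real, so they are too.\<close>
        have "z \<in> \<real>" if "J n z = 0" for z
        proof (cases "z = 0")
          case z: False
          then have "poly (g_star n F) (of_nat n / z) = 0"
            using that J_eq[of z n] False by simp
          then have "of_nat n / z \<in> \<real>" using 2 by (simp add: only_real_zeros_def)
          moreover have "z = of_nat n / (of_nat n / z)" using False by simp
          ultimately show ?thesis by (metis Reals_divide Reals_of_nat)
        qed simp
        then show ?thesis by (simp add: only_real_zeros_def)
      qed
    qed
  qed
qed

section \<open>Taylor coefficients and the equivalence\<close>

text \<open>Identifies the prescribed coefficients with derivatives at 0. Convergence at z = 1
  already gives the positive radius needed to differentiate termwise.\<close>

lemma exp_coeff_unique:
  assumes "\<And>z. (\<lambda>j. c j * z ^ j / fact j) sums F z"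
  shows "exp_coeff F j = c j"
proof -
  define A where "A = Abs_fps (\<lambda>j. c j / fact j)"
  have sums: "(\<lambda>j. fps_nth A j * z ^ j) sums F z" for z
    using assms[of z] by (simp add: A_def)
  then have "eval_fps A = F"
    by (auto simp: eval_fps_def sums_iff)
  moreover have "fps_conv_radius A \<ge> norm (1 :: complex)"
    unfolding fps_conv_radius_def by (rule conv_radius_geI) (rule sums_summable[OF sums])
  then have "fps_conv_radius A > 0"
    by (rule less_le_trans[rotated]) simp
  then have "fps_nth A j = (deriv ^^ j) (eval_fps A) 0 / fact j"
    by (rule fps_nth_conv_deriv)
  ultimately show ?thesis by (simp add: A_def exp_coeff_def)
qed

theorem theorem3p5:
  fixes \<Phi> \<Omega> :: "complex \<Rightarrow> complex" and c :: "nat \<Rightarrow> complex"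
  assumes "real_entire \<Phi>"
    and "genus_one_star \<Phi>"
    and "\<And>z. (\<lambda>j. c j * z ^ j / fact j) sums \<Phi> z"
    and "laguerre_polya \<Omega>"
  shows "only_real_zeros \<Phi> \<longleftrightarrow>
    (\<forall>d\<ge>1. poly_only_real_zeros
       (\<Sum>j=0..d. smult (of_nat (d choose j) * c j) (g_star (d - j) \<Omega>)))"
proof -
  have hol: "\<Phi> holomorphic_on UNIV" "\<Omega> holomorphic_on UNIV"
    using assms(1,4) by (auto simp: real_entire_def laguerre_polya_def)
  have sum_eq: "(\<Sum>j=0..d. smult (of_nat (d choose j) * c j) (g_star (d - j) \<Omega>)) =
      g_star d (\<lambda>z. \<Phi> z * \<Omega> z)" for d
    by (simp add: g_star_mult[OF hol] exp_coeff_unique[OF assms(3)])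
  \<comment> \<open>The polynomial for d = 0 is constant, so the range d \<ge> 1 already amounts to
    \<open>real_jensen\<close>.\<close>
  have "poly_only_real_zeros (g_star 0 (\<lambda>z. \<Phi> z * \<Omega> z))"
    by (auto simp: g_star_def monom_0 poly_only_real_zeros_def only_real_zeros_def)
  then have "(\<forall>d\<ge>1. poly_only_real_zeros (g_star d (\<lambda>z. \<Phi> z * \<Omega> z))) \<longleftrightarrow>
      real_jensen (\<lambda>z. \<Phi> z * \<Omega> z)"
    using hol by (auto simp: real_jensen_def not_less_eq_eq Suc_le_eq intro!: holomorphic_intros) (metis gr0I)
  moreover have "real_jensen (\<lambda>z. \<Phi> z * \<Omega> z)" if "only_real_zeros \<Phi>"
  proof -
    \<comment> \<open>Starting from 1, multiply first by \<Omega>, then by \<Phi>, both in the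
      Laguerre-Polya class.\<close>
    have "real_jensen (\<lambda>z. \<Omega> z * 1)"
      by (rule real_jensen_mult_laguerre_polya[OF real_jensen_1 assms(4)])
    moreover have "laguerre_polya \<Phi>" using assms(1,2) that by (simp add: laguerre_polya_def)
    ultimately show ?thesis using real_jensen_mult_laguerre_polya[of \<Omega> \<Phi>] by simp
  qed
  moreover have "only_real_zeros \<Phi>" if J: "real_jensen (\<lambda>z. \<Phi> z * \<Omega> z)"
  proof -
    \<comment> \<open>Hurwitz needs a limit that is not identically zero: both functions are nonzero
      on a punctured disc around 0, so any small x > 0 is a witness.\<close>
    obtain \<delta>1 where \<delta>1: "\<delta>1 > 0" "\<And>z. z \<noteq> 0 \<Longrightarrow> norm z < \<delta>1 \<Longrightarrow> \<Phi> z \<noteq> 0"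
      using genus_one_star_nonzero_near_0[OF assms(2)] by blast
    obtain \<delta>2 where \<delta>2: "\<delta>2 > 0" "\<And>z. z \<noteq> 0 \<Longrightarrow> norm z < \<delta>2 \<Longrightarrow> \<Omega> z \<noteq> 0"
      using genus_one_star_nonzero_near_0 assms(4) unfolding laguerre_polya_def by metis
    define x where "x = complex_of_real (min \<delta>1 \<delta>2 / 2)"
    have "x \<noteq> 0" "norm x < \<delta>1" "norm x < \<delta>2"
      using \<delta>1(1) \<delta>2(1) by (auto simp: x_def simp del: of_real_divide)
    then have "\<Phi> x * \<Omega> x \<noteq> 0" using \<delta>1(2) \<delta>2(2) by simp
    then have "(\<lambda>z. \<Phi> z * \<Omega> z) \<noteq> (\<lambda>_. 0)" by (auto simp: fun_eq_iff)
    from only_real_zeros_if_real_jensen[OF J this] show ?thesis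
      by (auto simp: only_real_zeros_def)
  qed
  ultimately show ?thesis by (auto simp: sum_eq)
qed

end
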